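(* Let $\alpha,\beta,\gamma,\delta,\varepsilon\in\mathbb{R}$ with $\alpha>0$ and $8\alpha\gamma\geq3\beta^2$, and let $h\colon\mathbb{R}\to\mathbb{R}$ be the (convex) quartic $h(x):=\alpha x^4+\beta x^3+\gamma x^2+\delta x+\varepsilon$. Let $y\in\mathbb{R}$. Then $$\operatorname{Prox}_h(y)=-\frac{\beta}{4\alpha}+\sqrt[3]{\frac{-q}{2}+\sqrt{\Delta}}+\sqrt[3]{\frac{-q}{2}-\sqrt{\Delta}},$$ where $$p:=\frac{4\alpha(1+2\gamma)-3\beta^2}{16\alpha^2},\qquad q:=\frac{8\alpha^2(\delta-y)+\beta^3-2\alpha\beta(1+2\gamma)}{32\alpha^3},$$ and $\Delta:=(p/3)^3+(q/2)^2\geq0$.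
   Context: $\operatorname{Prox}_h(y)$ denotes the proximal mapping of the convex function $h$ at $y$, i.e., the unique minimizer over $x\in\mathbb{R}$ of $h(x)+\tfrac12(x-y)^2$. For real $t$, $\sqrt[3]{t}$ denotes the unique real cube root of $t$ (also for negative $t$). *)

theory Defs
  imports "HOL-Analysis.Analysis"
begin

definition prox_objective :: "(real \<Rightarrow> real) \<Rightarrow> real \<Rightarrow> real \<Rightarrow> real" where
  "prox_objective h y x = h x + (1/2) * (x - y)^2"

(* Only meaningful when the minimizer exists and is unique;
   ex1_prox below shows that this holds for every convex h. *)
definition Prox :: "(real \<Rightarrow> real) \<Rightarrow> real \<Rightarrow> real" where
  "Prox h y = (THE x. is_arg_min (prox_objective h y) (\<lambda>_. True) x)"

lemma ex1_prox:
  fixes h :: "real \<Rightarrow> real"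
  assumes cvx: "convex_on UNIV h"
  shows "\<exists>!x. is_arg_min (prox_objective h y) (\<lambda>_. True) x"
proof -
  let ?g = "prox_objective h y"
  have am: "is_arg_min ?g (\<lambda>_. True) x \<longleftrightarrow> (\<forall>z. ?g x \<le> ?g z)" for x
    by (simp add: is_arg_min_linorder)
  obtain c where c: "h z \<ge> h y + c * (z - y)" for z
    using convex_le_Inf_differential[OF cvx, of y] by fastforce
  let ?K = "cball y (2 * \<bar>c\<bar>)"
  have "continuous_on UNIV h"
    using convex_on_continuous[OF _ cvx] by simp
  then have "continuous_on ?K ?g"
    unfolding prox_objective_def
    by (intro continuous_intros) (auto intro: continuous_on_subset)
  then obtain x where x: "\<And>z. z \<in> ?K \<Longrightarrow> ?g x \<le> ?g z"
    using continuous_attains_inf[of ?K ?g] compact_cball by (metis abs_ge_zero cball_eq_empty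
        mult_nonneg_nonneg not_less zero_le_numeral)
  have "?g x \<le> ?g z" for z
  proof (cases "z \<in> ?K")
    case False
    then have "2 * \<bar>c\<bar> * \<bar>z - y\<bar> \<le> \<bar>z - y\<bar> * \<bar>z - y\<bar>"
      by (intro mult_right_mono) (auto simp: dist_real_def)
    then have "2 * \<bar>c * (z - y)\<bar> \<le> (z - y)^2"
      by (simp add: abs_mult power2_eq_square)
    then have "?g z \<ge> h y"
      using c[of z] by (simp add: prox_objective_def)
    moreover have "?g x \<le> ?g y" using x by simp
    ultimately show ?thesis by (simp add: prox_objective_def)
  qed (use x in auto)
  moreover have "u = v" if u: "\<forall>z. ?g u \<le> ?g z" and v: "\<forall>z. ?g v \<le> ?g z" for u v
  proof (rule ccontr)
    assume "u \<noteq> v"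
    then have pos: "(u - v)^2 > 0" by simp
    have "h ((u + v) / 2) \<le> h u / 2 + h v / 2"
      using convex_onD[OF cvx, of "1/2" u v] by (simp add: field_simps)
    moreover have "((u + v) / 2 - y)^2 = (u - y)^2 / 2 + (v - y)^2 / 2 - (u - v)^2 / 4"
      by (simp add: power2_eq_square field_simps)
    ultimately have "?g ((u + v) / 2) < ?g u / 2 + ?g v / 2"
      unfolding prox_objective_def using pos by argo
    moreover have "?g u \<le> ?g ((u + v) / 2)" "?g v \<le> ?g ((u + v) / 2)"
      using u v by blast+
    ultimately show False by simp
  qed
  ultimately show ?thesis unfolding am by blast
qed

end

theory Submission
  imports Defs
begin

text \<open>Put \<open>b = \<beta> / (4\<alpha>)\<close> and \<open>t = x + b\<close>. Up to an additive constant, the proximal objective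
is then \<open>\<alpha> (t^4 + 2 p t^2 + 4 q t)\<close>, so that \<open>p\<close> and \<open>q\<close> are the coefficients of the depressed
cubic \<open>t^3 + p t + q\<close> at which its derivative vanishes. The hypothesis \<open>3\<beta>^2 \<le> 8\<alpha>\<gamma>\<close> says that the
quadratic \<open>h''\<close> has nonpositive discriminant, which gives convexity; the extra curvature \<open>1\<close>
contributed by the term \<open>(x - y)^2 / 2\<close> turns it into \<open>p > 0\<close>. Positivity of \<open>p\<close> makes
\<open>\<Delta>\<close> nonnegative, so Cardano's formula with real radicals gives a root \<open>s\<close> of the cubic
(lemma \<open>cardano_root\<close>). It also makes every root of the cubic a strict global minimizer of the
quartic (lemma \<open>depressed_quartic_strict_min\<close>), so the proximal point is \<open>s - b\<close>.\<close>

text \<open>The two radicals \<open>u\<close>, \<open>v\<close> satisfy \<open>u^3 + v^3 = -q\<close> and \<open>u v = -p/3\<close>, and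
\<open>(u + v)^3 = u^3 + v^3 + 3 u v (u + v)\<close>. The product comes out right without choosing
among cube roots because the real cube root is multiplicative.\<close>

lemma cardano_root:
  fixes p q \<Delta> :: real
  assumes D: "\<Delta> = (p / 3)^3 + (q / 2)^2" and nonneg: "\<Delta> \<ge> 0"
  defines "s \<equiv> root 3 (- q / 2 + sqrt \<Delta>) + root 3 (- q / 2 - sqrt \<Delta>)"
  shows "s^3 + p * s + q = 0"
proof -
  define u where "u = root 3 (- q / 2 + sqrt \<Delta>)"
  define v where "v = root 3 (- q / 2 - sqrt \<Delta>)"
  have cubes: "u^3 + v^3 = - q"
    unfolding u_def v_def by (simp add: odd_real_root_pow)
  have "(- q / 2 + sqrt \<Delta>) * (- q / 2 - sqrt \<Delta>) = (q / 2)^2 - (sqrt \<Delta>)^2"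
    by (simp add: power2_eq_square algebra_simps)
  also have "\<dots> = (- (p / 3))^3"
    using D nonneg by simp
  finally have "u * v = root 3 ((- (p / 3))^3)"
    unfolding u_def v_def by (simp only: real_root_mult[symmetric])
  then have "u * v = - (p / 3)"
    by (simp only: odd_real_root_power_cancel[OF odd_numeral])
  then have prod: "3 * (u * v) = - p" by simp
  have "(u + v)^3 = (u^3 + v^3) + (3 * (u * v)) * (u + v)"
    by (simp add: power3_eq_cube algebra_simps)
  then have "(u + v)^3 = - q - p * (u + v)"
    by (simp only: cubes prod)
  then show ?thesis
    unfolding s_def u_def v_def by simp
qed

text \<open>Since \<open>s\<close> is a critical point of the quartic, the difference of its values at \<open>t\<close> and
\<open>s\<close> is divisible by \<open>(t - s)^2\<close>; the cofactor is \<open>(t + s)^2 + 2 s^2 + 2 p\<close>, which is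
positive.\<close>

lemma depressed_quartic_strict_min:
  fixes p q s t :: real
  assumes root: "s^3 + p * s + q = 0" and "p > 0" and "t \<noteq> s"
  shows "s^4 + 2 * p * s^2 + 4 * q * s < t^4 + 2 * p * t^2 + 4 * q * t"
proof -
  have q: "q = - (s^3) - p * s" using root by linarith
  have "(t^4 + 2 * p * t^2 + 4 * q * t) - (s^4 + 2 * p * s^2 + 4 * q * s)
      = (t - s)^2 * ((t + s)^2 + 2 * s^2 + 2 * p)"
    unfolding q by (simp add: power2_eq_square power3_eq_cube power4_eq_xxxx algebra_simps)
  moreover have "(t + s)^2 + 2 * s^2 + 2 * p > 0"
    using \<open>p > 0\<close> by (simp add: add_nonneg_pos)
  ultimately show ?thesis
    using \<open>t \<noteq> s\<close> by (smt (verit) mult_pos_pos zero_less_power2)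
qed

lemma convex_on_quartic:
  fixes \<alpha> \<beta> \<gamma> \<delta> \<epsilon> :: real
  assumes "\<alpha> > 0" and disc: "8 * \<alpha> * \<gamma> \<ge> 3 * \<beta>^2"
  shows "convex_on UNIV (\<lambda>x. \<alpha> * x^4 + \<beta> * x^3 + \<gamma> * x^2 + \<delta> * x + \<epsilon>)"
proof (rule f''_ge0_imp_convex)
  fix x :: real
  show "((\<lambda>x. \<alpha> * x^4 + \<beta> * x^3 + \<gamma> * x^2 + \<delta> * x + \<epsilon>) has_real_derivative
      4 * \<alpha> * x^3 + 3 * \<beta> * x^2 + 2 * \<gamma> * x + \<delta>) (at x)"
    by (auto intro!: derivative_eq_intros)
  show "((\<lambda>x. 4 * \<alpha> * x^3 + 3 * \<beta> * x^2 + 2 * \<gamma> * x + \<delta>) has_real_derivative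
      12 * \<alpha> * x^2 + 6 * \<beta> * x + 2 * \<gamma>) (at x)"
    by (auto intro!: derivative_eq_intros)
  \<comment> \<open>Completing the square, with the factor \<open>12\<alpha>\<close> keeping the coefficients polynomial.\<close>
  have "12 * \<alpha> * (12 * \<alpha> * x^2 + 6 * \<beta> * x + 2 * \<gamma>)
      = (12 * \<alpha> * x + 3 * \<beta>)^2 + 3 * (8 * \<alpha> * \<gamma> - 3 * \<beta>^2)"
    by (simp add: power2_eq_square algebra_simps)
  then have "12 * \<alpha> * (12 * \<alpha> * x^2 + 6 * \<beta> * x + 2 * \<gamma>) \<ge> 0"
    using disc by simp
  then show "12 * \<alpha> * x^2 + 6 * \<beta> * x + 2 * \<gamma> \<ge> 0"
    using \<open>\<alpha> > 0\<close> by (simp add: zero_le_mult_iff)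
qed simp

lemma Prox_eqI:
  assumes "\<And>x. x \<noteq> z \<Longrightarrow> prox_objective h y z < prox_objective h y x"
  shows "Prox h y = z"
  unfolding Prox_def
proof (rule the_equality)
  show "is_arg_min (prox_objective h y) (\<lambda>_. True) z"
    unfolding is_arg_min_linorder using assms by (metis less_imp_le order_refl)
next
  fix x
  assume "is_arg_min (prox_objective h y) (\<lambda>_. True) x"
  then show "x = z"
    unfolding is_arg_min_linorder using assms by (meson not_less)
qed

theorem proposition4p3:
  fixes \<alpha> \<beta> \<gamma> \<delta> \<epsilon> y p q \<Delta> :: real
    and h :: "real \<Rightarrow> real"
  assumes "\<alpha> > 0"
    and "8 * \<alpha> * \<gamma> \<ge> 3 * \<beta>^2"
    and "h = (\<lambda>x. \<alpha> * x^4 + \<beta> * x^3 + \<gamma> * x^2 + \<delta> * x + \<epsilon>)"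
    and "p = (4 * \<alpha> * (1 + 2 * \<gamma>) - 3 * \<beta>^2) / (16 * \<alpha>^2)"
    and "q = (8 * \<alpha>^2 * (\<delta> - y) + \<beta>^3 - 2 * \<alpha> * \<beta> * (1 + 2 * \<gamma>)) / (32 * \<alpha>^3)"
    and "\<Delta> = (p / 3)^3 + (q / 2)^2"
  shows "convex_on UNIV h \<and> \<Delta> \<ge> 0 \<and>
    Prox h y = - \<beta> / (4 * \<alpha>) + root 3 (- q / 2 + sqrt \<Delta>) + root 3 (- q / 2 - sqrt \<Delta>)"
proof -
  have "4 * \<alpha> * (1 + 2 * \<gamma>) - 3 * \<beta>^2 = 4 * \<alpha> + (8 * \<alpha> * \<gamma> - 3 * \<beta>^2)"
    by (simp add: algebra_simps)
  then have "p > 0"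
    using assms(1,2,4) by simp
  then have "\<Delta> \<ge> 0"
    using assms(6) by simp
  define b where "b = \<beta> / (4 * \<alpha>)"
  define s where "s = root 3 (- q / 2 + sqrt \<Delta>) + root 3 (- q / 2 - sqrt \<Delta>)"
  have s: "s^3 + p * s + q = 0"
    unfolding s_def using cardano_root assms(6) \<open>\<Delta> \<ge> 0\<close> by blast
  \<comment> \<open>Solving for the original coefficients in terms of \<open>\<alpha>\<close>, \<open>b\<close>, \<open>p\<close>, \<open>q\<close> removes all
    divisions, so that the change of variable becomes a polynomial identity.\<close>
  have \<beta>: "\<beta> = 4 * \<alpha> * b"
    using assms(1) by (simp add: b_def)
  have \<gamma>: "\<gamma> = 2 * \<alpha> * p + 6 * \<alpha> * b^2 - 1 / 2"
    unfolding assms(4) \<beta> using assms(1) by (simp add: field_simps power2_eq_square)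
  have \<delta>: "\<delta> = y + 4 * \<alpha> * q - 8 * \<alpha> * b^3 + b * (1 + 2 * \<gamma>)"
    unfolding assms(5) \<beta> using assms(1)
    by (simp add: field_simps power2_eq_square power3_eq_cube)
  define Q where "Q t = t^4 + 2 * p * t^2 + 4 * q * t" for t :: real
  define c where "c = \<epsilon> + y^2 / 2 - \<alpha> * Q b"
  have objective: "prox_objective h y x = \<alpha> * Q (x + b) + c" for x
    unfolding prox_objective_def assms(3) Q_def c_def \<delta> \<gamma> \<beta>
    by (simp add: field_simps power2_eq_square power3_eq_cube power4_eq_xxxx)
  have "Prox h y = s - b"
  proof (rule Prox_eqI)
    fix x
    assume "x \<noteq> s - b"
    then have "Q s < Q (x + b)"
      unfolding Q_def using s \<open>p > 0\<close> by (intro depressed_quartic_strict_min) auto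
    then show "prox_objective h y (s - b) < prox_objective h y x"
      using assms(1) by (simp add: objective)
  qed
  then show ?thesis
    using convex_on_quartic[OF assms(1,2)] \<open>\<Delta> \<ge> 0\<close> unfolding assms(3) s_def b_def by simp
qed

end
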